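(* Let $a_1>\cdots>a_N>0$, let $\mathcal I_1,\dots,\mathcal I_N\subset\mathbb R$ be intervals, and let $u_i:(\frac12\mathbb Z+\frac14)\cap\mathcal I_i\to\mathbb R$, $i=1,\dots,N$, be sequences with $u_i(m)\ne-a_k$ for all $i,k,m$ and $u_i(m)\neq u_j(m')$ for all $i\ne j$, $m,m'$. Let $\mathcal V=\mathbb Z^N\cap\prod_i\mathcal I_i$ and $\mathcal V^*=(\mathbb Z+\frac12)^N\cap\prod_i\mathcal I_i$. Let $\boldsymbol x:\mathcal V\cup\mathcal V^*\to\mathbb R^N$ be a net all of whose points have non-vanishing components and which is obtained by the polarity construction, i.e. for any two neighboring points $\boldsymbol n$ and $\boldsymbol n+\frac12\boldsymbol\sigma$ of $\mathcal V\cup\mathcal V^*$, $\boldsymbol\sigma\in\{\pm1\}^N$, $$\boldsymbol x(\boldsymbol n+\tfrac12\boldsymbol\sigma)=\bigcap_{i=1}^NP_{Q(u_i)}(\boldsymbol x(\boldsymbol n)),\qquad u_i=u_i(n_i+\tfrac14\sigma_i).$$ Then the nets $\boldsymbol x(\mathcal V)$ and $\boldsymbol x(\mathcal V^* )$ are orthogonal: for each $i$ and each pair $\boldsymbol n,\boldsymbol n+\boldsymbol e_i$ both in $\mathcal V$ or both in $\mathcal V^*$, all points $\boldsymbol x(\boldsymbol n+\frac12\boldsymbol\sigma)$ with $\boldsymbol\sigma\in\{\pm1\}^N$, $\sigma_i=1$ and $\boldsymbol n+\frac12\boldsymbol\sigma\in\mathcal V\cup\mathcal V^*$ lie in a hyperplane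 orthogonal to the line through $\boldsymbol x(\boldsymbol n)$ and $\boldsymbol x(\boldsymbol n+\boldsymbol e_i)$ (i.e. orthogonal to the vector $\boldsymbol x(\boldsymbol n+\boldsymbol e_i)-\boldsymbol x(\boldsymbol n)$).
   Context: $Q(\lambda)=\{\boldsymbol x\in\mathbb R^N:\sum_{k=1}^Nx_k^2/(a_k+\lambda)=1\}$ denotes the quadrics of the confocal family, and for $\lambda\notin\{-a_1,\dots,-a_N\}$ the polar hyperplane of a point $\boldsymbol x\ne0$ with respect to $Q(\lambda)$ is $P_{Q(\lambda)}(\boldsymbol x)=\{\boldsymbol y\in\mathbb R^N:\sum_{k=1}^Nx_ky_k/(a_k+\lambda)=1\}$. $\boldsymbol e_i$ is the $i$-th coordinate unit vector. *)

theory Defs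
  imports "HOL-Analysis.Analysis"
begin

text \<open>The polar hyperplane of \<open>x\<close> with respect to the confocal quadric
  \<open>Q(lam) = {x. (\<Sum>k. x\<^sub>k\<^sup>2 / (a\<^sub>k + lam)) = 1}\<close>; meaningful for \<open>x \<noteq> 0\<close> and \<open>lam \<noteq> - a\<^sub>k\<close> for all \<open>k\<close>.\<close>
definition polar_hyperplane :: "real ^ 'n \<Rightarrow> real \<Rightarrow> real ^ 'n \<Rightarrow> (real ^ 'n) set" where
  "polar_hyperplane a lam x = {y. (\<Sum>k\<in>UNIV. x $ k * y $ k / (a $ k + lam)) = 1}"

definition sign_vectors :: "(real ^ 'n) set" where
  "sign_vectors = {\<sigma>. \<forall>i. \<sigma> $ i \<in> {1, -1}}"

definition integer_lattice :: "('n \<Rightarrow> real set) \<Rightarrow> (real ^ 'n) set" where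
  "integer_lattice I = {n. \<forall>i. n $ i \<in> \<int> \<inter> I i}"

definition dual_lattice :: "('n \<Rightarrow> real set) \<Rightarrow> (real ^ 'n) set" where
  "dual_lattice I = {n. \<forall>i. n $ i \<in> {z + 1/2 |z. z \<in> \<int>} \<inter> I i}"

definition quarter_points :: "real set" where
  "quarter_points = {z / 2 + 1/4 |z. z \<in> \<int>}"

text \<open>Functions on lattice points and parameter points are represented by total functions; only
  their values at points of the respective domains are constrained. The equation
  \<open>x(n + \<sigma>/2) = \<Inter>\<^sub>i P\<^sub>i\<close> of a point with an intersection of hyperplanes says that the intersection
  consists of exactly that point.\<close>
definition polarity_net ::
  "real ^ 'n \<Rightarrow> ('n \<Rightarrow> real set) \<Rightarrow> ('n \<Rightarrow> real \<Rightarrow> real) \<Rightarrow> (real ^ 'n \<Rightarrow> real ^ 'n) \<Rightarrow> bool" where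
  "polarity_net a I u x \<longleftrightarrow>
     (\<forall>n \<in> integer_lattice I \<union> dual_lattice I. \<forall>\<sigma> \<in> sign_vectors.
        n + (1/2) *\<^sub>R \<sigma> \<in> integer_lattice I \<union> dual_lattice I \<longrightarrow>
        (\<Inter>i. polar_hyperplane a (u i (n $ i + \<sigma> $ i / 4)) (x n)) = {x (n + (1/2) *\<^sub>R \<sigma>)})"

definition is_hyperplane :: "'a::euclidean_space set \<Rightarrow> bool" where
  "is_hyperplane H \<longleftrightarrow> (\<exists>v c. v \<noteq> 0 \<and> H = {y. v \<bullet> y = c})"

text \<open>Orthogonality of the direction space of \<open>H\<close> to \<open>d\<close>. For \<open>d \<noteq> 0\<close> this says that the
  hyperplane \<open>H\<close> has normal vector \<open>d\<close>.\<close>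
definition orthogonal_to_hyperplane :: "'a::euclidean_space \<Rightarrow> 'a set \<Rightarrow> bool" where
  "orthogonal_to_hyperplane d H \<longleftrightarrow> is_hyperplane H \<and> (\<forall>y\<in>H. \<forall>z\<in>H. orthogonal (y - z) d)"

end

theory Submission
  imports Defs "HOL-Computational_Algebra.Polynomial"
begin

text \<open>
  Write \<open>N\<close> for the dimension. If \<open>y\<close> lies on the polar hyperplanes of \<open>x\<close> with respect to
  confocal quadrics with \<open>N\<close> distinct parameters \<open>u\<^sub>j\<close>, then \<open>x \<bullet> y\<close> depends only on the
  parameters: \<open>x \<bullet> y = (\<Sum>k. a\<^sub>k) + (\<Sum>j. u\<^sub>j)\<close>. The reason is that the function
  \<open>s \<mapsto> 1 - (\<Sum>k. x\<^sub>k y\<^sub>k / (a\<^sub>k + s))\<close> vanishes at all \<open>u\<^sub>j\<close>, hence equals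
  \<open>(\<Prod>j. s - u\<^sub>j) / (\<Prod>k. a\<^sub>k + s)\<close>, and the claim compares the terms of order \<open>1/s\<close> for
  large \<open>s\<close> (\<open>sum_residues_eq\<close>, \<open>inner_eq_if_polar\<close>).

  A point \<open>y = x(n + \<sigma>/2)\<close> with \<open>\<sigma>\<^sub>i = 1\<close> is a neighbour of both \<open>x(n)\<close> and \<open>x(n + e\<^sub>i)\<close>.
  The two sets of parameters differ only in direction \<open>i\<close>, where they are the values of
  \<open>u\<^sub>i\<close> at \<open>n\<^sub>i + 1/4\<close> and \<open>n\<^sub>i + 3/4\<close>. Subtracting the two inner products,
  \<open>(x(n + e\<^sub>i) - x(n)) \<bullet> y = u\<^sub>i(n\<^sub>i + 3/4) - u\<^sub>i(n\<^sub>i + 1/4)\<close>, and the right-hand side does not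
  depend on the other components of \<open>\<sigma>\<close>. This is the hyperplane sought, provided
  \<open>x(n + e\<^sub>i) \<noteq> x(n)\<close>. If the two points coincide, orthogonality is trivial, and the points \<open>y\<close>
  still share a hyperplane: the polar of \<open>x(n) \<noteq> 0\<close> for the parameter \<open>u\<^sub>i(n\<^sub>i + 1/4)\<close>.
\<close>

lemma degree_prod_linear_factors:
  fixes f :: "'b \<Rightarrow> 'a::idom"
  assumes "finite A"
  shows "degree (\<Prod>k\<in>A. [:f k, 1:]) = card A"
  using assms by (subst degree_prod_eq_sum_degree) auto

lemma lead_coeff_prod_linear_factors:
  fixes f :: "'b \<Rightarrow> 'a::idom"
  assumes "finite A"
  shows "coeff (\<Prod>k\<in>A. [:f k, 1:]) (card A) = 1"
  using lead_coeff_prod[of "\<lambda>k. [:f k, 1:]" A] degree_prod_linear_factors[OF assms, of f] by simp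

lemma subleading_coeff_prod_linear_factors:
  fixes f :: "'b \<Rightarrow> 'a::idom"
  assumes "finite A" "card A = Suc m"
  shows "coeff (\<Prod>k\<in>A. [:f k, 1:]) m = (\<Sum>k\<in>A. f k)"
  using assms
proof (induction A arbitrary: m rule: finite_induct)
  case empty
  then show ?case by simp
next
  case (insert b A)
  then have m: "m = card A" by simp
  have lead: "coeff (\<Prod>k\<in>A. [:f k, 1:]) m = 1"
    using insert.hyps lead_coeff_prod_linear_factors[of A f] m by simp
  show ?case
  proof (cases m)
    case 0
    with m insert.hyps have "A = {}" by simp
    then show ?thesis using 0 by simp
  next
    case (Suc l)
    have "coeff (\<Prod>k\<in>A. [:f k, 1:]) l = (\<Sum>k\<in>A. f k)"
      using insert.IH[of l] Suc m by simp
    then show ?thesis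
      using insert.hyps lead Suc by simp
  qed
qed

text \<open>
  Multiplying \<open>1 - (\<Sum>k. X\<^sub>k / (a\<^sub>k + s))\<close> by the common denominator gives a monic polynomial of
  degree \<open>card A\<close> with root set \<open>U\<close>, so it is \<open>\<Prod>v\<in>U. s - v\<close>; the conclusion equates the
  subleading coefficients.
\<close>
lemma sum_residues_eq:
  fixes a X :: "'b \<Rightarrow> 'a::field"
  assumes "finite A" "finite U" "card U = card A" "A \<noteq> {}"
    and nonsing: "\<And>v k. v \<in> U \<Longrightarrow> k \<in> A \<Longrightarrow> a k + v \<noteq> 0"
    and eq: "\<And>v. v \<in> U \<Longrightarrow> (\<Sum>k\<in>A. X k / (a k + v)) = 1"
  shows "(\<Sum>k\<in>A. X k) = (\<Sum>k\<in>A. a k) + \<Sum>U"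
proof -
  obtain m where m: "card A = Suc m"
    using assms(1,4) by (metis card_eq_0_iff not0_implies_Suc)
  define P where "P = (\<Prod>k\<in>A. [:a k, 1:])"
  define R where "R = (\<Prod>v\<in>U. [:- v, 1:])"
  define Q where "Q = (\<Sum>k\<in>A. smult (X k) (\<Prod>l\<in>A - {k}. [:a l, 1:]))"
  have cardk: "card (A - {k}) = m" if "k \<in> A" for k
    using that m assms(1) by simp
  have "degree (P - R) \<le> m"
  proof (rule degree_le, intro allI impI)
    fix d assume "m < d"
    then consider "d = Suc m" | "d > Suc m" by linarith
    then show "coeff (P - R) d = 0"
    proof cases
      case 1
      then show ?thesis
        using lead_coeff_prod_linear_factors[OF assms(1), of a]
          lead_coeff_prod_linear_factors[OF assms(2), of uminus] assms(3) m
        by (simp add: P_def R_def)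
    next
      case 2
      then show ?thesis
        using degree_prod_linear_factors[OF assms(1), of a]
          degree_prod_linear_factors[OF assms(2), of uminus] assms(3) m
        by (simp add: P_def R_def coeff_eq_0)
    qed
  qed
  moreover have "degree Q \<le> m"
    unfolding Q_def
  proof (rule degree_sum_le[OF assms(1)])
    fix k assume "k \<in> A"
    then show "degree (smult (X k) (\<Prod>l\<in>A - {k}. [:a l, 1:])) \<le> m"
      using degree_prod_linear_factors[of "A - {k}" a] assms(1) cardk
      by (metis degree_smult_le finite_Diff)
  qed
  moreover have "poly (P - R) v = poly Q v" if v: "v \<in> U" for v
  proof -
    have "poly R v = 0"
      using v assms(2) by (auto simp: R_def poly_prod)
    moreover have "poly P v = (\<Prod>l\<in>A. a l + v) * (\<Sum>k\<in>A. X k / (a k + v))"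
      using eq[OF v] by (simp add: P_def poly_prod add.commute)
    moreover have "(\<Prod>l\<in>A. a l + v) * (X k / (a k + v)) = X k * (\<Prod>l\<in>A - {k}. a l + v)"
      if "k \<in> A" for k
      using nonsing[OF v that] prod.remove[OF assms(1) that, of "\<lambda>l. a l + v"] by simp
    ultimately show ?thesis
      by (simp add: Q_def poly_sum poly_prod sum_distrib_left add.commute)
  qed
  ultimately have "P - R = Q"
    using assms(3) m by (intro poly_eqI_degree[of U]) auto
  then have "coeff P m - coeff R m = coeff Q m"
    by (metis coeff_diff)
  moreover have "coeff P m = (\<Sum>k\<in>A. a k)"
    unfolding P_def using assms(1) m by (rule subleading_coeff_prod_linear_factors)
  moreover have "coeff R m = - \<Sum>U"
    using subleading_coeff_prod_linear_factors[of U m uminus] assms(2,3) m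
    by (simp add: R_def sum_negf)
  moreover have "coeff (\<Prod>l\<in>A - {k}. [:a l, 1:]) m = 1" if "k \<in> A" for k
    using lead_coeff_prod_linear_factors[of "A - {k}" a] assms(1) cardk[OF that] by simp
  then have "coeff Q m = (\<Sum>k\<in>A. X k)"
    by (simp add: Q_def coeff_sum)
  ultimately show ?thesis by simp
qed

lemma inner_eq_if_polar:
  fixes a x y :: "real ^ 'n" and w :: "'n \<Rightarrow> real"
  assumes "inj w"
    and nonsing: "\<And>j k. w j \<noteq> - a $ k"
    and polar: "\<And>j. y \<in> polar_hyperplane a (w j) x"
  shows "x \<bullet> y = (\<Sum>k\<in>UNIV. a $ k) + (\<Sum>j\<in>UNIV. w j)"
proof -
  have "(\<Sum>k\<in>UNIV. x $ k * y $ k) = (\<Sum>k\<in>UNIV. a $ k) + \<Sum>(range w)"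
  proof (rule sum_residues_eq)
    show "card (range w) = card (UNIV :: 'n set)"
      using assms(1) by (rule card_image)
    fix v assume v: "v \<in> range w"
    then show "(\<Sum>k\<in>UNIV. x $ k * y $ k / (a $ k + v)) = 1"
      using polar by (auto simp: polar_hyperplane_def)
    show "a $ k + v \<noteq> 0" for k
      using v nonsing by (metis add_eq_0_iff rangeE)
  qed auto
  moreover have "\<Sum>(range w) = (\<Sum>j\<in>UNIV. w j)"
    using assms(1) by (simp add: sum.reindex)
  ultimately show ?thesis
    by (simp add: inner_vec_def)
qed

lemma polar_hyperplane_is_hyperplane:
  fixes a x :: "real ^ 'n"
  assumes "x \<noteq> 0" and nonsing: "\<And>k. lam \<noteq> - a $ k"
  shows "is_hyperplane (polar_hyperplane a lam x)"
  unfolding is_hyperplane_def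
proof (intro exI conjI)
  let ?v = "\<chi> k. x $ k / (a $ k + lam)"
  have "a $ k + lam \<noteq> 0" for k
    using nonsing by (metis add_eq_0_iff)
  with assms(1) show "?v \<noteq> 0"
    by (auto simp: vec_eq_iff)
  show "polar_hyperplane a lam x = {y. ?v \<bullet> y = 1}"
    by (simp add: polar_hyperplane_def inner_vec_def)
qed

lemma lattice_coordinate:
  assumes "n \<in> integer_lattice I \<union> dual_lattice I"
  shows "n $ j \<in> I j" and "2 * n $ j \<in> \<int>"
proof -
  show "n $ j \<in> I j"
    using assms by (auto simp: integer_lattice_def dual_lattice_def)
  from assms consider "n $ j \<in> \<int>" | "n $ j \<in> {z + 1/2 |z. z \<in> \<int>}"
    unfolding integer_lattice_def dual_lattice_def by blast
  then show "2 * n $ j \<in> \<int>"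
  proof cases
    case 2
    then obtain z where "z \<in> \<int>" and z: "n $ j = z + 1/2" by blast
    then have "2 * z + 1 \<in> \<int>" by simp
    then show ?thesis unfolding z by simp
  qed simp
qed

text \<open>
  The parameter attached to an edge sits at the midpoint of the edge, so being in the domain of
  \<open>u\<^sub>j\<close> is convexity of \<open>I\<^sub>j\<close>.
\<close>
lemma edge_parameter_mem:
  assumes "is_interval (I j)" "\<sigma> \<in> sign_vectors"
    and "n \<in> integer_lattice I \<union> dual_lattice I"
    and "n + (1/2) *\<^sub>R \<sigma> \<in> integer_lattice I \<union> dual_lattice I"
  shows "n $ j + \<sigma> $ j / 4 \<in> quarter_points \<inter> I j"
proof
  have s: "\<sigma> $ j = 1 \<or> \<sigma> $ j = -1"
    using assms(2) by (auto simp: sign_vectors_def)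
  have "2 * n $ j \<in> \<int>"
    using assms(3) by (rule lattice_coordinate)
  with s have "2 * n $ j + (\<sigma> $ j - 1) / 2 \<in> \<int>"
    by auto
  moreover have "n $ j + \<sigma> $ j / 4 = (2 * n $ j + (\<sigma> $ j - 1) / 2) / 2 + 1/4"
    by (simp add: field_simps)
  ultimately show "n $ j + \<sigma> $ j / 4 \<in> quarter_points"
    unfolding quarter_points_def by blast
  have ends: "n $ j \<in> I j" "n $ j + \<sigma> $ j / 2 \<in> I j"
    using lattice_coordinate(1)[OF assms(3)] lattice_coordinate(1)[OF assms(4), of j] by auto
  have "(n $ j \<le> n $ j + \<sigma> $ j / 4 \<and> n $ j + \<sigma> $ j / 4 \<le> n $ j + \<sigma> $ j / 2) \<or>
        (n $ j + \<sigma> $ j / 2 \<le> n $ j + \<sigma> $ j / 4 \<and> n $ j + \<sigma> $ j / 4 \<le> n $ j)"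
    using s by auto
  then show "n $ j + \<sigma> $ j / 4 \<in> I j"
    using ends assms(1) unfolding is_interval_1 by blast
qed

theorem theorem6p3:
  fixes a :: "real ^ ('n::{finite,linorder})"
    and I :: "'n \<Rightarrow> real set"
    and u :: "'n \<Rightarrow> real \<Rightarrow> real"
    and x :: "real ^ ('n::{finite,linorder}) \<Rightarrow> real ^ ('n::{finite,linorder})"
  assumes a_decreasing: "\<And>i j. i < j \<Longrightarrow> a $ i > a $ j"
    and a_pos: "\<And>i. a $ i > 0"
    and intervals: "\<And>i. is_interval (I i)"
    and u_nonsingular: "\<And>i k m. m \<in> quarter_points \<inter> I i \<Longrightarrow> u i m \<noteq> - a $ k"
    and u_distinct: "\<And>i j m m'. i \<noteq> j \<Longrightarrow> m \<in> quarter_points \<inter> I i \<Longrightarrow>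
                       m' \<in> quarter_points \<inter> I j \<Longrightarrow> u i m \<noteq> u j m'"
    and x_nonzero: "\<And>n k. n \<in> integer_lattice I \<union> dual_lattice I \<Longrightarrow> x n $ k \<noteq> 0"
    and polarity: "polarity_net a I u x"
  shows "\<forall>i n. (n \<in> integer_lattice I \<and> n + axis i 1 \<in> integer_lattice I) \<or>
               (n \<in> dual_lattice I \<and> n + axis i 1 \<in> dual_lattice I) \<longrightarrow>
           (\<exists>H. orthogonal_to_hyperplane (x (n + axis i 1) - x n) H \<and>
                (\<forall>\<sigma> \<in> sign_vectors. \<sigma> $ i = 1 \<longrightarrow>
                   n + (1/2) *\<^sub>R \<sigma> \<in> integer_lattice I \<union> dual_lattice I \<longrightarrow>
                   x (n + (1/2) *\<^sub>R \<sigma>) \<in> H))"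
proof (intro allI impI)
  fix i n
  assume "(n \<in> integer_lattice I \<and> n + axis i 1 \<in> integer_lattice I) \<or>
          (n \<in> dual_lattice I \<and> n + axis i 1 \<in> dual_lattice I)"
  then have n: "n \<in> integer_lattice I \<union> dual_lattice I"
    and n': "n + axis i 1 \<in> integer_lattice I \<union> dual_lattice I"
    by auto
  define d where "d = x (n + axis i 1) - x n"
  define admissible where "admissible \<sigma> \<longleftrightarrow> \<sigma> \<in> sign_vectors \<and> \<sigma> $ i = 1 \<and>
    n + (1/2) *\<^sub>R \<sigma> \<in> integer_lattice I \<union> dual_lattice I" for \<sigma>

  have polar: "x (p + (1/2) *\<^sub>R \<tau>) \<in> polar_hyperplane a (u j (p $ j + \<tau> $ j / 4)) (x p)"
    if "p \<in> integer_lattice I \<union> dual_lattice I" "\<tau> \<in> sign_vectors"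
      "p + (1/2) *\<^sub>R \<tau> \<in> integer_lattice I \<union> dual_lattice I" for p \<tau> j
  proof -
    have "(\<Inter>j. polar_hyperplane a (u j (p $ j + \<tau> $ j / 4)) (x p)) = {x (p + (1/2) *\<^sub>R \<tau>)}"
      using polarity that unfolding polarity_net_def by blast
    then show ?thesis by blast
  qed
  have edge_inner: "x p \<bullet> x (p + (1/2) *\<^sub>R \<tau>)
      = (\<Sum>k\<in>UNIV. a $ k) + (\<Sum>j\<in>UNIV. u j (p $ j + \<tau> $ j / 4))"
    if "p \<in> integer_lattice I \<union> dual_lattice I" "\<tau> \<in> sign_vectors"
      "p + (1/2) *\<^sub>R \<tau> \<in> integer_lattice I \<union> dual_lattice I" for p \<tau>
  proof (rule inner_eq_if_polar)
    note mem = edge_parameter_mem[OF intervals that(2,1,3)]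
    show "inj (\<lambda>j. u j (p $ j + \<tau> $ j / 4))"
      using u_distinct[OF _ mem mem] by (meson injI)
    show "u j (p $ j + \<tau> $ j / 4) \<noteq> - a $ k" for j k
      using mem by (rule u_nonsingular)
  qed (rule polar[OF that])

  have inner_d: "d \<bullet> x (n + (1/2) *\<^sub>R \<sigma>) = u i (n $ i + 3/4) - u i (n $ i + 1/4)"
    if "admissible \<sigma>" for \<sigma>
  proof -
    from that have \<sigma>: "\<sigma> \<in> sign_vectors" and \<sigma>i: "\<sigma> $ i = 1"
      and y: "n + (1/2) *\<^sub>R \<sigma> \<in> integer_lattice I \<union> dual_lattice I"
      by (auto simp: admissible_def)
    \<comment> \<open>The same point is reached from \<open>n + e\<^sub>i\<close> by reversing the \<open>i\<close>-th sign.\<close>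
    define \<tau> where "\<tau> = \<sigma> - 2 *\<^sub>R axis i 1"
    have \<tau>: "\<tau> $ j = (if j = i then -1 else \<sigma> $ j)" for j
      using \<sigma>i by (simp add: \<tau>_def axis_def)
    have \<tau>_sign: "\<tau> \<in> sign_vectors"
      using \<sigma> by (auto simp: sign_vectors_def \<tau>)
    have same: "n + axis i 1 + (1/2) *\<^sub>R \<tau> = n + (1/2) *\<^sub>R \<sigma>"
      by (simp add: \<tau>_def algebra_simps)
    have "x (n + axis i 1) \<bullet> x (n + (1/2) *\<^sub>R \<sigma>)
        = (\<Sum>k\<in>UNIV. a $ k) + (\<Sum>j\<in>UNIV. u j ((n + axis i 1) $ j + \<tau> $ j / 4))"
      using edge_inner[OF n' \<tau>_sign] same y by simp
    also have "(\<Sum>j\<in>UNIV. u j ((n + axis i 1) $ j + \<tau> $ j / 4))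
        = u i (n $ i + 3/4) + (\<Sum>j\<in>UNIV - {i}. u j (n $ j + \<sigma> $ j / 4))"
      by (subst sum.remove[of _ i]) (auto simp: \<tau> axis_def add_ac intro!: sum.cong)
    finally have "x (n + axis i 1) \<bullet> x (n + (1/2) *\<^sub>R \<sigma>) = (\<Sum>k\<in>UNIV. a $ k) +
        (u i (n $ i + 3/4) + (\<Sum>j\<in>UNIV - {i}. u j (n $ j + \<sigma> $ j / 4)))" .
    moreover have "x n \<bullet> x (n + (1/2) *\<^sub>R \<sigma>) = (\<Sum>k\<in>UNIV. a $ k) +
        (u i (n $ i + 1/4) + (\<Sum>j\<in>UNIV - {i}. u j (n $ j + \<sigma> $ j / 4)))"
      unfolding edge_inner[OF n \<sigma> y] by (subst sum.remove[of _ i]) (auto simp: \<sigma>i)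
    ultimately show ?thesis
      by (simp add: d_def inner_diff_left)
  qed

  have "\<exists>H. orthogonal_to_hyperplane d H \<and> (\<forall>\<sigma>. admissible \<sigma> \<longrightarrow> x (n + (1/2) *\<^sub>R \<sigma>) \<in> H)"
  proof (cases "d = 0")
    case False
    let ?H = "{y. d \<bullet> y = u i (n $ i + 3/4) - u i (n $ i + 1/4)}"
    have "is_hyperplane ?H"
      using False unfolding is_hyperplane_def by blast
    moreover have "orthogonal (y - z) d" if "y \<in> ?H" "z \<in> ?H" for y z
      using that by (simp add: orthogonal_def inner_diff_left inner_commute[of _ d] inner_diff_right)
    ultimately have "orthogonal_to_hyperplane d ?H"
      unfolding orthogonal_to_hyperplane_def by blast
    then show ?thesis
      using inner_d by blast
  next
    case True
    let ?H = "polar_hyperplane a (u i (n $ i + 1/4)) (x n)"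
    have "n $ i + 1/4 \<in> quarter_points \<inter> I i"
    proof
      have "2 * n $ i \<in> \<int>"
        using n by (rule lattice_coordinate)
      moreover have "n $ i + 1/4 = (2 * n $ i) / 2 + 1/4" by simp
      ultimately show "n $ i + 1/4 \<in> quarter_points"
        unfolding quarter_points_def by blast
      have "n $ i \<in> I i" "n $ i + 1 \<in> I i"
        using lattice_coordinate(1)[OF n, of i] lattice_coordinate(1)[OF n', of i]
        by (simp_all add: axis_def)
      moreover have "n $ i \<le> n $ i + 1/4" "n $ i + 1/4 \<le> n $ i + 1" by simp_all
      ultimately show "n $ i + 1/4 \<in> I i"
        using intervals[of i] unfolding is_interval_1 by blast
    qed
    then have "u i (n $ i + 1/4) \<noteq> - a $ k" for k
      by (rule u_nonsingular)
    moreover have "x n \<noteq> 0"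
      using x_nonzero[OF n, of i] by auto
    ultimately have "orthogonal_to_hyperplane d ?H"
      using True polar_hyperplane_is_hyperplane
      by (auto simp: orthogonal_to_hyperplane_def orthogonal_def)
    moreover have "x (n + (1/2) *\<^sub>R \<sigma>) \<in> ?H" if "admissible \<sigma>" for \<sigma>
      using that polar[OF n, of \<sigma> i] by (simp add: admissible_def)
    ultimately show ?thesis by blast
  qed
  then show "\<exists>H. orthogonal_to_hyperplane (x (n + axis i 1) - x n) H \<and>
      (\<forall>\<sigma> \<in> sign_vectors. \<sigma> $ i = 1 \<longrightarrow>
         n + (1/2) *\<^sub>R \<sigma> \<in> integer_lattice I \<union> dual_lattice I \<longrightarrow>
         x (n + (1/2) *\<^sub>R \<sigma>) \<in> H)"
    unfolding d_def admissible_def by blast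
qed

end
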